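(* Let $H\in(0,1/2)$. The statistics $$\widehat H_k=\frac12\left(1-\frac1k\log_2V_{2^k}^{H,2}\right)\qquad\text{and}\qquad \widetilde H_k=\frac12\left(\log_2\frac{V_{2^k}^{H,2}}{V_{2^{k+1}}^{H,2}}+1\right)$$ are strongly consistent estimators of the Hurst parameter $H$; that is, $\widehat H_k\to H$ and $\widetilde H_k\to H$ almost surely as $k\to\infty$.
   Context: Mixed model: $M_t^H=aB_t^H+bW_t$, $t\in[0,T]$, where $T>0$, $a>0$, $b>0$, $W$ is a standard Wiener process and $B^H$ is a fractional Brownian motion with Hurst parameter $H$ (centered Gaussian, $\mathsf{E}[B^H_tB^H_s]=\frac12(t^{2H}+s^{2H}-|t-s|^{2H})$), independent of $W$. For $n\ge1$, $\Delta_i^nX=X_{T(i+1)/n}-X_{Ti/n}$, $i=0,\dots,n-1$, and $V_n^{H,2}=\sum_{i=0}^{n-1}(\Delta_i^nM^H)^2$. *)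

theory Defs
  imports "HOL-Probability.Probability"
begin

text \<open>Point masses count as Gaussian, as usual for Gaussian processes; \<open>normal_density\<close> only
  covers positive variance.\<close>

definition gaussian_rv :: "'a measure \<Rightarrow> ('a \<Rightarrow> real) \<Rightarrow> bool" where
  "gaussian_rv P X \<longleftrightarrow> X \<in> borel_measurable P \<and>
     ((\<exists>\<mu>. AE \<omega> in P. X \<omega> = \<mu>) \<or>
      (\<exists>\<mu> \<sigma>. \<sigma> > 0 \<and> distributed P lborel X (normal_density \<mu> \<sigma>)))"

definition gaussian_process :: "'a measure \<Rightarrow> real set \<Rightarrow> (real \<Rightarrow> 'a \<Rightarrow> real) \<Rightarrow> bool" where
  "gaussian_process P I X \<longleftrightarrow>
     (\<forall>F c. finite F \<and> F \<subseteq> I \<longrightarrow> gaussian_rv P (\<lambda>\<omega>. \<Sum>t\<in>F. c t * X t \<omega>))"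

definition fractional_Brownian_motion ::
    "'a measure \<Rightarrow> real \<Rightarrow> real set \<Rightarrow> (real \<Rightarrow> 'a \<Rightarrow> real) \<Rightarrow> bool" where
  "fractional_Brownian_motion P H I B \<longleftrightarrow>
     0 < H \<and> H < 1 \<and> gaussian_process P I B \<and>
     (\<forall>t\<in>I. prob_space.expectation P (B t) = 0) \<and>
     (\<forall>t\<in>I. \<forall>s\<in>I. prob_space.expectation P (\<lambda>\<omega>. B t \<omega> * B s \<omega>) =
        1 / 2 * (t powr (2 * H) + s powr (2 * H) - \<bar>t - s\<bar> powr (2 * H)))"

definition standard_Wiener_process ::
    "'a measure \<Rightarrow> real set \<Rightarrow> (real \<Rightarrow> 'a \<Rightarrow> real) \<Rightarrow> bool" where
  "standard_Wiener_process P I W \<longleftrightarrow>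
     (\<forall>t\<in>I. W t \<in> borel_measurable P) \<and>
     (AE \<omega> in P. W 0 \<omega> = 0) \<and>
     (\<forall>s\<in>I. \<forall>t\<in>I. s < t \<longrightarrow>
        distributed P lborel (\<lambda>\<omega>. W t \<omega> - W s \<omega>) (normal_density 0 (sqrt (t - s)))) \<and>
     (\<forall>(n::nat) \<tau>. (\<forall>i\<le>n. \<tau> i \<in> I) \<and> (\<forall>i<n. \<tau> i \<le> \<tau> (Suc i)) \<longrightarrow>
        prob_space.indep_vars P (\<lambda>_. borel) (\<lambda>i \<omega>. W (\<tau> (Suc i)) \<omega> - W (\<tau> i) \<omega>) {..<n}) \<and>
     (AE \<omega> in P. continuous_on I (\<lambda>t. W t \<omega>))"

text \<open>Independence of the two processes as random elements of the path space with its product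
  sigma-algebra, i.e. of the sigma-algebras they generate.\<close>

definition independent_processes ::
    "'a measure \<Rightarrow> real set \<Rightarrow> (real \<Rightarrow> 'a \<Rightarrow> real) \<Rightarrow> (real \<Rightarrow> 'a \<Rightarrow> real) \<Rightarrow> bool" where
  "independent_processes P I X Y \<longleftrightarrow>
     prob_space.indep_var P
       (Pi\<^sub>M I (\<lambda>_. borel)) (\<lambda>\<omega>. \<lambda>t\<in>I. X t \<omega>)
       (Pi\<^sub>M I (\<lambda>_. borel)) (\<lambda>\<omega>. \<lambda>t\<in>I. Y t \<omega>)"

definition mixed_process ::
    "real \<Rightarrow> real \<Rightarrow> (real \<Rightarrow> 'a \<Rightarrow> real) \<Rightarrow> (real \<Rightarrow> 'a \<Rightarrow> real) \<Rightarrow> real \<Rightarrow> 'a \<Rightarrow> real" where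
  "mixed_process a b B W t \<omega> = a * B t \<omega> + b * W t \<omega>"

definition increment :: "real \<Rightarrow> nat \<Rightarrow> nat \<Rightarrow> (real \<Rightarrow> 'a \<Rightarrow> real) \<Rightarrow> 'a \<Rightarrow> real" where
  "increment T n i X \<omega> = X (T * (real i + 1) / real n) \<omega> - X (T * real i / real n) \<omega>"

definition quadratic_variation :: "real \<Rightarrow> nat \<Rightarrow> (real \<Rightarrow> 'a \<Rightarrow> real) \<Rightarrow> 'a \<Rightarrow> real" where
  "quadratic_variation T n X \<omega> = (\<Sum>i<n. (increment T n i X \<omega>)\<^sup>2)"

text \<open>The estimators are functions of the observed process alone: they take neither \<open>H\<close> nor the
  coefficients \<open>a\<close>, \<open>b\<close>.\<close>

definition H_hat :: "real \<Rightarrow> (real \<Rightarrow> 'a \<Rightarrow> real) \<Rightarrow> nat \<Rightarrow> 'a \<Rightarrow> real" where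
  "H_hat T X k \<omega> = 1 / 2 * (1 - 1 / real k * log 2 (quadratic_variation T (2 ^ k) X \<omega>))"

definition H_tilde :: "real \<Rightarrow> (real \<Rightarrow> 'a \<Rightarrow> real) \<Rightarrow> nat \<Rightarrow> 'a \<Rightarrow> real" where
  "H_tilde T X k \<omega> =
     1 / 2 * (log 2 (quadratic_variation T (2 ^ k) X \<omega> /
                     quadratic_variation T (2 ^ (k + 1)) X \<omega>) + 1)"

end

theory Submission imports Defs begin

text \<open>Scaled by \<open>n powr (2 * H - 1)\<close>, the quadratic variation of the fractional part tends almost
  surely to \<open>T powr (2 * H)\<close> along \<open>n = 2 ^ k\<close>: for \<open>H < 1 / 2\<close> disjoint increments are negatively
  correlated, while all covariances sum to a second moment, so the squared covariances are
  controlled by the trace and the variance is of order \<open>1 / n\<close>, which is summable over \<open>n = 2 ^ k\<close>.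
  The scaled Wiener part has expectation of order \<open>n powr (2 * H - 1)\<close>, also summable, hence
  vanishes, and Cauchy-Schwarz disposes of the cross term. Taking logarithms gives both
  estimators.\<close>

section \<open>Analytic and probabilistic preliminaries\<close>

text \<open>Concavity of the power: its increment over a step of length \<open>k\<close> shrinks as
  the base point moves from \<open>x\<close> to \<open>x + h\<close>. With \<open>p = 2 * H\<close>
  this determines the sign of the covariances of disjoint increments.\<close>

lemma powr_add_increment_le:
  fixes x h k p :: real
  assumes "0 \<le> x" "0 \<le> h" "0 \<le> k" "0 < p" "p < 1"
  shows "(x + h + k) powr p + x powr p \<le> (x + h) powr p + (x + k) powr p"
proof -
  have "(x + h + k) powr p - (x + h) powr p \<le> (x + k) powr p - x powr p"
  \<comment> \<open>The derivative is taken on the open interval only, because \<open>x = 0\<close>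
    is allowed and the power is not differentiable there; continuity covers the endpoints.\<close>
  proof (rule DERIV_nonpos_imp_decreasing_open[where f = "\<lambda>y. (y + k) powr p - y powr p"])
    show "x \<le> x + h" using assms by simp
    fix y assume "x < y" "y < x + h"
    then have y: "y > 0" using assms by simp
    have "((\<lambda>y. (y + k) powr p - y powr p) has_real_derivative
        p * (y + k) powr (p - 1) - p * y powr (p - 1)) (at y)"
      using y assms by (auto intro!: derivative_eq_intros)
    moreover have "p * (y + k) powr (p - 1) \<le> p * y powr (p - 1)"
      using y assms by (intro mult_left_mono powr_mono2') auto
    ultimately show "\<exists>d. ((\<lambda>y. (y + k) powr p - y powr p) has_real_derivative d) (at y) \<and> d \<le> 0"
      by force
  next
    show "continuous_on {x..x + h} (\<lambda>y. (y + k) powr p - y powr p)"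
      using assms by (intro continuous_on_diff continuous_on_powr' continuous_intros) auto
  qed
  then show ?thesis by simp
qed

text \<open>Takes the place of Markov's inequality with Borel-Cantelli: expectation and series
  commute for nonnegative terms, so the random series has finite mean, hence converges almost
  surely, and its terms tend to 0.\<close>

lemma (in prob_space) AE_tendsto_zero_of_summable_expectation:
  fixes Z :: "nat \<Rightarrow> 'a \<Rightarrow> real"
  assumes int: "\<And>k. integrable M (Z k)" and nonneg: "\<And>k \<omega>. 0 \<le> Z k \<omega>"
    and summ: "summable (\<lambda>k. expectation (Z k))"
  shows "AE \<omega> in M. (\<lambda>k. Z k \<omega>) \<longlonglongrightarrow> 0"
proof -
  have [measurable]: "Z k \<in> borel_measurable M" for k using int by auto
  have "(\<integral>\<^sup>+\<omega>. (\<Sum>k. ennreal (Z k \<omega>)) \<partial>M) = (\<Sum>k. \<integral>\<^sup>+\<omega>. ennreal (Z k \<omega>) \<partial>M)"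
    by (rule nn_integral_suminf) simp
  also have "\<dots> = (\<Sum>k. ennreal (expectation (Z k)))"
    using int nonneg by (simp add: nn_integral_eq_integral)
  also have "\<dots> \<noteq> \<infinity>"
    using ennreal_suminf_neq_top[OF summ Bochner_Integration.integral_nonneg[OF nonneg]]
    by (simp only: infinity_ennreal_def not_False_eq_True)
  finally have "(\<integral>\<^sup>+\<omega>. (\<Sum>k. ennreal (Z k \<omega>)) \<partial>M) \<noteq> \<infinity>" .
  then have "AE \<omega> in M. (\<Sum>k. ennreal (Z k \<omega>)) \<noteq> \<infinity>"
    by (rule nn_integral_PInf_AE[rotated]) measurable
  then show ?thesis
  proof eventually_elim
    case (elim \<omega>)
    then have "summable (\<lambda>k. Z k \<omega>)"
      by (intro summable_suminf_not_top nonneg) (simp only: infinity_ennreal_def not_False_eq_True)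
    then show ?case by (rule summable_LIMSEQ_zero)
  qed
qed

section \<open>Moments of Gaussian variables and of sums of their squares\<close>

lemma distributed_normal_even_moment:
  assumes D: "distributed M lborel X (normal_density \<mu> \<sigma>)" and "\<sigma> > 0"
  shows "integrable M (\<lambda>\<omega>. (X \<omega> - \<mu>) ^ (2 * k))"
    and "(\<integral>\<omega>. (X \<omega> - \<mu>) ^ (2 * k) \<partial>M) = fact (2 * k) / ((2 / \<sigma>\<^sup>2) ^ k * fact k)"
  using distributed_integrable[OF D, of "\<lambda>x. (x - \<mu>) ^ (2 * k)"]
    distributed_integral[OF D, of "\<lambda>x. (x - \<mu>) ^ (2 * k)"]
    normal_moment_even[OF \<open>\<sigma> > 0\<close>, of \<mu> k]
  by (auto simp: has_bochner_integral_iff)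

lemma (in prob_space) gaussian_rv_integrable:
  assumes "gaussian_rv M X"
  shows "integrable M X"
  using assms unfolding gaussian_rv_def
proof (elim conjE disjE exE)
  fix \<mu> assume X: "X \<in> borel_measurable M" and "AE \<omega> in M. X \<omega> = \<mu>"
  then show ?thesis
    using integrable_cong_AE[of X M "\<lambda>_. \<mu>"] by simp
next
  fix \<mu> \<sigma> assume "0 < \<sigma>" and D: "distributed M lborel X (normal_density \<mu> \<sigma>)"
  then show ?thesis
    by (intro distributed_integrable_var[OF D]) (auto simp: integrable_normal_moment_nz_1)
qed

text \<open>A centered point mass sits at 0, where both sides of the fourth moment identity vanish;
  otherwise the identity comes from the even moments of the normal density.\<close>

lemma (in prob_space) gaussian_rv_centered_moments:
  assumes "gaussian_rv M X" and E: "expectation X = 0"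
  shows "integrable M (\<lambda>\<omega>. (X \<omega>)\<^sup>2)" "integrable M (\<lambda>\<omega>. X \<omega> ^ 4)"
    "expectation (\<lambda>\<omega>. X \<omega> ^ 4) = 3 * (expectation (\<lambda>\<omega>. (X \<omega>)\<^sup>2))\<^sup>2"
proof -
  have X[measurable]: "X \<in> borel_measurable M" using assms by (simp add: gaussian_rv_def)
  have "integrable M (\<lambda>\<omega>. (X \<omega>)\<^sup>2) \<and> integrable M (\<lambda>\<omega>. X \<omega> ^ 4) \<and>
    expectation (\<lambda>\<omega>. X \<omega> ^ 4) = 3 * (expectation (\<lambda>\<omega>. (X \<omega>)\<^sup>2))\<^sup>2"
    using assms(1) unfolding gaussian_rv_def
  proof (elim conjE disjE exE)
    fix \<mu> assume ae: "AE \<omega> in M. X \<omega> = \<mu>"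
    then have "expectation X = \<mu>"
      by (subst integral_cong_AE[of _ _ "\<lambda>_. \<mu>"]) (auto simp: prob_space)
    then have ae: "AE \<omega> in M. X \<omega> = 0" using ae E by simp
    then have "AE \<omega> in M. X \<omega> ^ n = 0" if "n > 0" for n
      by eventually_elim (use that in simp)
    then have "integrable M (\<lambda>\<omega>. X \<omega> ^ n)" "expectation (\<lambda>\<omega>. X \<omega> ^ n) = 0" if "n > 0" for n
      using that integrable_cong_AE[of "\<lambda>\<omega>. X \<omega> ^ n" M "\<lambda>_. 0"]
        integral_cong_AE[of "\<lambda>\<omega>. X \<omega> ^ n" M "\<lambda>_. 0"] by auto
    then show ?thesis by simp
  next
    fix \<mu> \<sigma> assume s: "0 < \<sigma>" and D: "distributed M lborel X (normal_density \<mu> \<sigma>)"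
    have "expectation X = \<mu>"
      using distributed_integral[OF D, of "\<lambda>x. x"] s by (simp add: integral_normal_moment_nz_1)
    then have [simp]: "\<mu> = 0" using E by simp
    have [simp]: "fact 4 = (24::real)" by (simp add: fact_numeral)
    show ?thesis
      \<comment> \<open>The second moment is \<open>\<sigma>^2\<close>, the fourth is
        \<open>24 * \<sigma>^4 / (4 * 2) = 3 * \<sigma>^4\<close>.\<close>
      using distributed_normal_even_moment[OF D s, of 1] distributed_normal_even_moment[OF D s, of 2] s
      by (simp add: power_divide)
  qed
  then show "integrable M (\<lambda>\<omega>. (X \<omega>)\<^sup>2)" "integrable M (\<lambda>\<omega>. X \<omega> ^ 4)"
    "expectation (\<lambda>\<omega>. X \<omega> ^ 4) = 3 * (expectation (\<lambda>\<omega>. (X \<omega>)\<^sup>2))\<^sup>2" by auto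
qed

text \<open>Polarization: everything is read off from the moments of \<open>X + Y\<close> and \<open>X - Y\<close>.\<close>

lemma (in prob_space) isserlis_squares:
  assumes G: "\<And>\<alpha> \<beta>. gaussian_rv M (\<lambda>\<omega>. \<alpha> * X \<omega> + \<beta> * Y \<omega>)"
    and EX: "expectation X = 0" and EY: "expectation Y = 0"
  shows "integrable M (\<lambda>\<omega>. X \<omega> * Y \<omega>)" "integrable M (\<lambda>\<omega>. (X \<omega>)\<^sup>2 * (Y \<omega>)\<^sup>2)"
    "expectation (\<lambda>\<omega>. (X \<omega>)\<^sup>2 * (Y \<omega>)\<^sup>2) =
      expectation (\<lambda>\<omega>. (X \<omega>)\<^sup>2) * expectation (\<lambda>\<omega>. (Y \<omega>)\<^sup>2) + 2 * (expectation (\<lambda>\<omega>. X \<omega> * Y \<omega>))\<^sup>2"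
proof -
  have gX: "gaussian_rv M X" and gY: "gaussian_rv M Y"
    and gp: "gaussian_rv M (\<lambda>\<omega>. X \<omega> + Y \<omega>)" and gm: "gaussian_rv M (\<lambda>\<omega>. X \<omega> - Y \<omega>)"
    using G[of 1 0] G[of 0 1] G[of 1 1] G[of 1 "-1"] by simp_all
  note [simp] = gaussian_rv_integrable[OF gX] gaussian_rv_integrable[OF gY]
  have Ep: "expectation (\<lambda>\<omega>. X \<omega> + Y \<omega>) = 0" and Em: "expectation (\<lambda>\<omega>. X \<omega> - Y \<omega>) = 0"
    using EX EY by simp_all
  note mX = gaussian_rv_centered_moments[OF gX EX]
    and mY = gaussian_rv_centered_moments[OF gY EY]
    and mp = gaussian_rv_centered_moments[OF gp Ep]
    and mm = gaussian_rv_centered_moments[OF gm Em]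
  have xy: "X \<omega> * Y \<omega> = ((X \<omega> + Y \<omega>)\<^sup>2 - (X \<omega> - Y \<omega>)\<^sup>2) / 4" for \<omega>
    by (simp add: power2_eq_square algebra_simps)
  \<comment> \<open>Odd mixed powers cancel in \<open>(x + y)^4 + (x - y)^4\<close>, which leaves
    \<open>2 * x^4 + 12 * x^2 * y^2 + 2 * y^4\<close>.\<close>
  have x2y2: "(X \<omega>)\<^sup>2 * (Y \<omega>)\<^sup>2 =
      ((X \<omega> + Y \<omega>) ^ 4 + (X \<omega> - Y \<omega>) ^ 4 - 2 * X \<omega> ^ 4 - 2 * Y \<omega> ^ 4) / 12" for \<omega>
    by (simp add: power2_eq_square power4_eq_xxxx algebra_simps)
  show iXY: "integrable M (\<lambda>\<omega>. X \<omega> * Y \<omega>)"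
    unfolding xy using mp mm by simp
  show "integrable M (\<lambda>\<omega>. (X \<omega>)\<^sup>2 * (Y \<omega>)\<^sup>2)"
    unfolding x2y2 using mp mm mX mY by simp
  define s t c where "s = expectation (\<lambda>\<omega>. (X \<omega>)\<^sup>2)" "t = expectation (\<lambda>\<omega>. (Y \<omega>)\<^sup>2)"
    "c = expectation (\<lambda>\<omega>. X \<omega> * Y \<omega>)"
  have p: "expectation (\<lambda>\<omega>. (X \<omega> + Y \<omega>)\<^sup>2) = s + t + 2 * c"
    using mX mY iXY unfolding power2_sum by (simp add: s_t_c_def mult.assoc)
  have m: "expectation (\<lambda>\<omega>. (X \<omega> - Y \<omega>)\<^sup>2) = s + t - 2 * c"
    using mX mY iXY unfolding power2_diff by (simp add: s_t_c_def mult.assoc)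
  have "expectation (\<lambda>\<omega>. (X \<omega>)\<^sup>2 * (Y \<omega>)\<^sup>2) =
    (3 * (s + t + 2 * c)\<^sup>2 + 3 * (s + t - 2 * c)\<^sup>2 - 2 * (3 * s\<^sup>2) - 2 * (3 * t\<^sup>2)) / 12"
    unfolding x2y2 using mp mm mX mY by (simp add: p m flip: s_t_c_def)
  also have "\<dots> = s * t + 2 * c\<^sup>2"
    by (simp add: power2_eq_square algebra_simps)
  finally show "expectation (\<lambda>\<omega>. (X \<omega>)\<^sup>2 * (Y \<omega>)\<^sup>2) =
      expectation (\<lambda>\<omega>. (X \<omega>)\<^sup>2) * expectation (\<lambda>\<omega>. (Y \<omega>)\<^sup>2) + 2 * (expectation (\<lambda>\<omega>. X \<omega> * Y \<omega>))\<^sup>2"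
    by (simp add: s_t_c_def)
qed

text \<open>By Isserlis' formula the left side is twice the sum of all squared covariances. One
  factor of each square is bounded by \<open>s\<close>, and the sign condition bounds the sum of the
  remaining absolute values, so the growth in \<open>card A\<close> is linear instead of
  quadratic.\<close>

lemma (in prob_space) variance_sum_squares_le:
  fixes X :: "'i \<Rightarrow> 'a \<Rightarrow> real" and s :: real
  assumes "finite A"
    and G: "\<And>i j \<alpha> \<beta>. i \<in> A \<Longrightarrow> j \<in> A \<Longrightarrow> gaussian_rv M (\<lambda>\<omega>. \<alpha> * X i \<omega> + \<beta> * X j \<omega>)"
    and E: "\<And>i. i \<in> A \<Longrightarrow> expectation (X i) = 0"
    and s: "\<And>i. i \<in> A \<Longrightarrow> expectation (\<lambda>\<omega>. (X i \<omega>)\<^sup>2) = s"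
    and neg: "\<And>i j. i \<in> A \<Longrightarrow> j \<in> A \<Longrightarrow> i \<noteq> j \<Longrightarrow> expectation (\<lambda>\<omega>. X i \<omega> * X j \<omega>) \<le> 0"
  shows "integrable M (\<lambda>\<omega>. ((\<Sum>i\<in>A. (X i \<omega>)\<^sup>2) - card A * s)\<^sup>2)"
    and "expectation (\<lambda>\<omega>. ((\<Sum>i\<in>A. (X i \<omega>)\<^sup>2) - card A * s)\<^sup>2) \<le> 4 * card A * s\<^sup>2"
proof -
  define c where "c i j = expectation (\<lambda>\<omega>. X i \<omega> * X j \<omega>)" for i j
  have g: "gaussian_rv M (X i)" if "i \<in> A" for i
    using G[OF that that, of 1 0] by simp
  note [simp] = gaussian_rv_centered_moments(1)[OF g E]
    isserlis_squares(1,2)[OF G E E]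
  have fourth: "expectation (\<lambda>\<omega>. (X i \<omega>)\<^sup>2 * (X j \<omega>)\<^sup>2) = s\<^sup>2 + 2 * (c i j)\<^sup>2" if "i \<in> A" "j \<in> A" for i j
    using isserlis_squares(3)[OF G E E, OF that that] that
    by (simp add: s c_def power2_eq_square[of s])
  have expand: "((\<Sum>i\<in>A. (X i \<omega>)\<^sup>2) - card A * s)\<^sup>2 = (\<Sum>i\<in>A. \<Sum>j\<in>A. (X i \<omega>)\<^sup>2 * (X j \<omega>)\<^sup>2)
      - 2 * card A * s * (\<Sum>i\<in>A. (X i \<omega>)\<^sup>2) + (card A * s)\<^sup>2" for \<omega>
    unfolding power2_diff power2_eq_square[of "\<Sum>i\<in>A. (X i \<omega>)\<^sup>2"] sum_product by simp
  show "integrable M (\<lambda>\<omega>. ((\<Sum>i\<in>A. (X i \<omega>)\<^sup>2) - card A * s)\<^sup>2)"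
    unfolding expand by simp
  have eq: "expectation (\<lambda>\<omega>. ((\<Sum>i\<in>A. (X i \<omega>)\<^sup>2) - card A * s)\<^sup>2) = 2 * (\<Sum>i\<in>A. \<Sum>j\<in>A. (c i j)\<^sup>2)"
  proof -
    have "expectation (\<lambda>\<omega>. ((\<Sum>i\<in>A. (X i \<omega>)\<^sup>2) - card A * s)\<^sup>2) =
        (\<Sum>i\<in>A. \<Sum>j\<in>A. s\<^sup>2 + 2 * (c i j)\<^sup>2) - 2 * card A * s * (\<Sum>i\<in>A. s) + (card A * s)\<^sup>2"
      unfolding expand by (simp add: fourth s prob_space)
    also have "\<dots> = 2 * (\<Sum>i\<in>A. \<Sum>j\<in>A. (c i j)\<^sup>2)"
      by (simp add: sum.distrib sum_distrib_left power2_eq_square algebra_simps)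
    finally show ?thesis .
  qed
  have ci: "c i i = s" if "i \<in> A" for i
    using s[OF that] by (simp add: c_def power2_eq_square)
  have c_abs: "\<bar>c i j\<bar> \<le> s" if ij: "i \<in> A" "j \<in> A" for i j
  proof -
    \<comment> \<open>These two second moments equal \<open>2 * s + 2 * c i j\<close> and
      \<open>2 * s - 2 * c i j\<close>, which gives both halves of the bound.\<close>
    have "0 \<le> expectation (\<lambda>\<omega>. (X i \<omega> + X j \<omega>)\<^sup>2)" "0 \<le> expectation (\<lambda>\<omega>. (X i \<omega> - X j \<omega>)\<^sup>2)"
      by simp_all
    then show ?thesis
      unfolding power2_sum power2_diff using ij by (simp add: s c_def mult.assoc abs_le_iff)
  qed
  \<comment> \<open>Off the diagonal the covariances are nonpositive, and all of them together sum to a second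
    moment; hence their absolute values sum to at most twice the trace.\<close>
  have "0 \<le> expectation (\<lambda>\<omega>. (\<Sum>i\<in>A. X i \<omega>)\<^sup>2)" by simp
  also have "\<dots> = (\<Sum>i\<in>A. \<Sum>j\<in>A. c i j)"
    unfolding power2_eq_square sum_product by (simp add: c_def)
  finally have total: "0 \<le> (\<Sum>i\<in>A. \<Sum>j\<in>A. c i j)" .
  \<comment> \<open>Flipping the sign of every covariance is right off the diagonal; the diagonal
    entry \<open>s\<close> then needs \<open>2 * s\<close> added back.\<close>
  have "(\<Sum>i\<in>A. \<Sum>j\<in>A. \<bar>c i j\<bar>) = (\<Sum>i\<in>A. \<Sum>j\<in>A. (if i = j then 2 * s else 0) - c i j)"
  proof (intro sum.cong refl)
    fix i j assume ij: "i \<in> A" "j \<in> A"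
    show "\<bar>c i j\<bar> = (if i = j then 2 * s else 0) - c i j"
      using ci[OF ij(1)] c_abs[OF ij] neg[OF ij] by (auto simp: c_def)
  qed
  also have "\<dots> = 2 * card A * s - (\<Sum>i\<in>A. \<Sum>j\<in>A. c i j)"
    using \<open>finite A\<close> by (simp add: sum_subtractf)
  finally have abs_sum: "(\<Sum>i\<in>A. \<Sum>j\<in>A. \<bar>c i j\<bar>) \<le> 2 * card A * s" using total by simp
  have "(\<Sum>i\<in>A. \<Sum>j\<in>A. (c i j)\<^sup>2) \<le> (\<Sum>i\<in>A. \<Sum>j\<in>A. s * \<bar>c i j\<bar>)"
  proof (intro sum_mono)
    fix i j assume ij: "i \<in> A" "j \<in> A"
    have "(c i j)\<^sup>2 = \<bar>c i j\<bar> * \<bar>c i j\<bar>" by (simp add: power2_eq_square)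
    also have "\<dots> \<le> s * \<bar>c i j\<bar>" using c_abs[OF ij] by (intro mult_right_mono) auto
    finally show "(c i j)\<^sup>2 \<le> s * \<bar>c i j\<bar>" .
  qed
  also have "\<dots> = s * (\<Sum>i\<in>A. \<Sum>j\<in>A. \<bar>c i j\<bar>)" by (simp add: sum_distrib_left)
  also have "\<dots> \<le> s * (2 * card A * s)"
  \<comment> \<open>The sign of \<open>s\<close> is known only through a member of \<open>A\<close>;
    for empty \<open>A\<close> both sides are 0.\<close>
  proof (cases "A = {}")
    case False
    then obtain i where "i \<in> A" by blast
    have "0 \<le> expectation (\<lambda>\<omega>. (X i \<omega>)\<^sup>2)" by simp
    then have "0 \<le> s" using s[OF \<open>i \<in> A\<close>] by simp
    then show ?thesis by (intro mult_left_mono abs_sum)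
  qed simp
  finally show "expectation (\<lambda>\<omega>. ((\<Sum>i\<in>A. (X i \<omega>)\<^sup>2) - card A * s)\<^sup>2) \<le> 4 * card A * s\<^sup>2"
    unfolding eq by (simp add: power2_eq_square[of s] mult_ac)
qed

section \<open>Increments of fractional Brownian motion\<close>

text \<open>\<open>gaussian_process\<close> allows one coefficient per time point, while adjacent
  increments share an endpoint. Coefficients built from indicators add up correctly whichever of the
  four times coincide.\<close>

lemma gaussian_process_increments:
  assumes "gaussian_process P I B" and st: "s \<in> I" "t \<in> I" "u \<in> I" "v \<in> I"
  shows "gaussian_rv P (\<lambda>\<omega>. \<alpha> * (B t \<omega> - B s \<omega>) + \<beta> * (B v \<omega> - B u \<omega>))"
proof -
  let ?F = "{s, t, u, v}"
  let ?c = "\<lambda>r. \<alpha> * (of_bool (r = t) - of_bool (r = s)) + \<beta> * (of_bool (r = v) - of_bool (r = u))"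
  have pick: "(\<Sum>r\<in>?F. of_bool (r = w) * B r \<omega>) = B w \<omega>" if "w \<in> ?F" for w \<omega>
  proof -
    have "(\<Sum>r\<in>?F. of_bool (r = w) * B r \<omega>) = (\<Sum>r\<in>?F. if w = r then B r \<omega> else 0)"
      by (intro sum.cong) auto
    then show ?thesis using that by (subst (asm) sum.delta') simp_all
  qed
  have "(\<Sum>r\<in>?F. ?c r * B r \<omega>) = \<alpha> * ((\<Sum>r\<in>?F. of_bool (r = t) * B r \<omega>) - (\<Sum>r\<in>?F. of_bool (r = s) * B r \<omega>))
     + \<beta> * ((\<Sum>r\<in>?F. of_bool (r = v) * B r \<omega>) - (\<Sum>r\<in>?F. of_bool (r = u) * B r \<omega>))" for \<omega>
    unfolding sum_subtractf[symmetric] sum_distrib_left sum.distrib[symmetric]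
    by (intro sum.cong refl) (simp only: algebra_simps)
  then have "(\<Sum>r\<in>?F. ?c r * B r \<omega>) = \<alpha> * (B t \<omega> - B s \<omega>) + \<beta> * (B v \<omega> - B u \<omega>)" for \<omega>
    using pick by simp
  moreover have "gaussian_rv P (\<lambda>\<omega>. \<Sum>r\<in>?F. ?c r * B r \<omega>)"
    using assms(1)[unfolded gaussian_process_def, rule_format, of ?F ?c] st by blast
  ultimately show ?thesis by (simp only:)
qed

lemma gaussian_process_pair:
  assumes "gaussian_process P I B" and st: "s \<in> I" "t \<in> I"
  shows "gaussian_rv P (\<lambda>\<omega>. \<alpha> * B s \<omega> + \<beta> * B t \<omega>)"
proof (cases "s = t")
  case True
  have "gaussian_rv P (\<lambda>\<omega>. \<Sum>r\<in>{s}. (\<alpha> + \<beta>) * B r \<omega>)"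
    using assms(1)[unfolded gaussian_process_def, rule_format, of "{s}" "\<lambda>_. \<alpha> + \<beta>"] st by blast
  then show ?thesis using True by (simp add: algebra_simps)
next
  case False
  have "gaussian_rv P (\<lambda>\<omega>. \<Sum>r\<in>{s, t}. (if r = s then \<alpha> else \<beta>) * B r \<omega>)"
    using assms(1)[unfolded gaussian_process_def, rule_format, of "{s, t}" "\<lambda>r. if r = s then \<alpha> else \<beta>"] st by blast
  then show ?thesis using False by (simp add: algebra_simps)
qed

lemma (in prob_space) fBm_integrable:
  assumes "fractional_Brownian_motion M H I B" and "t \<in> I"
  shows "integrable M (B t)"
  using assms gaussian_rv_integrable[OF gaussian_process_pair[of M I B t t 1 0]]
  by (simp add: fractional_Brownian_motion_def)

lemma (in prob_space) fBm_increments_mean: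
  assumes B: "fractional_Brownian_motion M H I B" and "s \<in> I" "t \<in> I"
  shows "expectation (\<lambda>\<omega>. B t \<omega> - B s \<omega>) = 0"
  using assms fBm_integrable[OF B] by (simp add: fractional_Brownian_motion_def)

text \<open>When the product is expanded, the terms depending on a single time cancel and only time
  differences survive, so the increments are stationary.\<close>

lemma (in prob_space) fBm_increments_covariance:
  assumes B: "fractional_Brownian_motion M H I B"
    and st: "s \<in> I" "t \<in> I" "u \<in> I" "v \<in> I"
  shows "expectation (\<lambda>\<omega>. (B t \<omega> - B s \<omega>) * (B v \<omega> - B u \<omega>)) =
      1 / 2 * (\<bar>t - u\<bar> powr (2 * H) + \<bar>s - v\<bar> powr (2 * H)
        - \<bar>t - v\<bar> powr (2 * H) - \<bar>s - u\<bar> powr (2 * H))"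
proof -
  have gp: "gaussian_process M I B"
    and E: "\<And>t. t \<in> I \<Longrightarrow> expectation (B t) = 0"
    and C: "\<And>t s. t \<in> I \<Longrightarrow> s \<in> I \<Longrightarrow> expectation (\<lambda>\<omega>. B t \<omega> * B s \<omega>) =
        1 / 2 * (t powr (2 * H) + s powr (2 * H) - \<bar>t - s\<bar> powr (2 * H))"
    using B by (auto simp: fractional_Brownian_motion_def)
  have i2: "integrable M (\<lambda>\<omega>. B t \<omega> * B s \<omega>)" if "t \<in> I" "s \<in> I" for t s
    using isserlis_squares(1)[OF gaussian_process_pair[OF gp that] E E] that by simp
  have "expectation (\<lambda>\<omega>. (B t \<omega> - B s \<omega>) * (B v \<omega> - B u \<omega>)) =
    expectation (\<lambda>\<omega>. B t \<omega> * B v \<omega> - B t \<omega> * B u \<omega> - B s \<omega> * B v \<omega> + B s \<omega> * B u \<omega>)"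
    by (simp add: algebra_simps)
  also have "\<dots> = expectation (\<lambda>\<omega>. B t \<omega> * B v \<omega>) - expectation (\<lambda>\<omega>. B t \<omega> * B u \<omega>)
      - expectation (\<lambda>\<omega>. B s \<omega> * B v \<omega>) + expectation (\<lambda>\<omega>. B s \<omega> * B u \<omega>)"
    using i2 st by simp
  also have "\<dots> = 1 / 2 * (\<bar>t - u\<bar> powr (2 * H) + \<bar>s - v\<bar> powr (2 * H)
        - \<bar>t - v\<bar> powr (2 * H) - \<bar>s - u\<bar> powr (2 * H))"
    using C st by (simp add: field_simps)
  finally show ?thesis .
qed

text \<open>This is where \<open>H < 1 / 2\<close> makes the exponent \<open>2 * H\<close>
  concave.\<close>

lemma (in prob_space) fBm_disjoint_increments_nonpos:
  assumes B: "fractional_Brownian_motion M H I B" and "H < 1 / 2"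
    and I: "s \<in> I" "t \<in> I" "u \<in> I" "v \<in> I" and ord: "s \<le> t" "t \<le> u" "u \<le> v"
  shows "expectation (\<lambda>\<omega>. (B t \<omega> - B s \<omega>) * (B v \<omega> - B u \<omega>)) \<le> 0"
proof -
  have "0 < H" using B by (simp add: fractional_Brownian_motion_def)
  \<comment> \<open>The base point is the gap \<open>u - t\<close> between the intervals, and the
    two steps are the interval lengths; the four sums are \<open>v - s\<close>,
    \<open>u - t\<close>, \<open>v - t\<close> and \<open>u - s\<close>.\<close>
  then have "(u - t + (v - u) + (t - s)) powr (2 * H) + (u - t) powr (2 * H)
      \<le> (u - t + (v - u)) powr (2 * H) + (u - t + (t - s)) powr (2 * H)"
    using assms by (intro powr_add_increment_le) auto
  moreover have "\<bar>t - u\<bar> = u - t" "\<bar>s - v\<bar> = v - s" "\<bar>t - v\<bar> = v - t" "\<bar>s - u\<bar> = u - s"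
    using ord by auto
  ultimately show ?thesis
    unfolding fBm_increments_covariance[OF B I] by (simp add: algebra_simps)
qed


section \<open>Moments of the quadratic variations on a uniform grid\<close>

lemma grid_point_in_interval:
  assumes "0 \<le> T" "i \<le> n"
  shows "T * real i / real n \<in> {0..T}"
  \<comment> \<open>For \<open>n = 0\<close> the quotient is 0 by the convention on division by
    zero.\<close>
  using assms by (cases "n = 0") (simp_all add: divide_le_eq mult_left_mono)

text \<open>All increments have the common variance \<open>\<sigma>\<close> and are pairwise
  nonpositively correlated, so \<open>variance_sum_squares_le\<close> applies. Relative to the
  squared mean \<open>(n * \<sigma>)^2\<close> the bound is \<open>4 / n\<close>.\<close>

lemma (in prob_space) fBm_quadratic_variation:
  assumes B: "fractional_Brownian_motion M H {0..T} B" and H: "H < 1 / 2" and "0 < T" "0 < n"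
  defines "\<sigma> \<equiv> (T / real n) powr (2 * H)"
  shows "integrable M (\<lambda>\<omega>. (quadratic_variation T n B \<omega> - real n * \<sigma>)\<^sup>2)"
    and "expectation (\<lambda>\<omega>. (quadratic_variation T n B \<omega> - real n * \<sigma>)\<^sup>2) \<le> 4 * real n * \<sigma>\<^sup>2"
proof -
  have inc: "increment T n i B = (\<lambda>\<omega>. B (T * real (Suc i) / real n) \<omega> - B (T * real i / real n) \<omega>)" for i
    by (simp add: increment_def fun_eq_iff add.commute)
  have grid: "T * real i / real n \<in> {0..T}" if "i \<le> n" for i
    using that \<open>0 < T\<close> by (intro grid_point_in_interval) auto
  have lt: "T * real i / real n \<le> T * real j / real n" if "i \<le> j" for i j
    using that \<open>0 < T\<close> by (intro divide_right_mono mult_left_mono) auto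
  have gp: "gaussian_process M {0..T} B" using B by (simp add: fractional_Brownian_motion_def)
  have G: "gaussian_rv M (\<lambda>\<omega>. \<alpha> * increment T n i B \<omega> + \<beta> * increment T n j B \<omega>)"
    if "i \<in> {..<n}" "j \<in> {..<n}" for i j \<alpha> \<beta>
    unfolding inc using that by (intro gaussian_process_increments[OF gp] grid) auto
  have E: "expectation (increment T n i B) = 0" if "i \<in> {..<n}" for i
    unfolding inc using that by (intro fBm_increments_mean[OF B] grid) auto
  have S: "expectation (\<lambda>\<omega>. (increment T n i B \<omega>)\<^sup>2) = \<sigma>" if "i \<in> {..<n}" for i
  proof -
    have "\<bar>T * real (Suc i) / real n - T * real i / real n\<bar> = T / real n"
      using \<open>0 < T\<close> by (simp add: diff_divide_distrib[symmetric] algebra_simps)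
    moreover from this have "\<bar>T * real i / real n - T * real (Suc i) / real n\<bar> = T / real n"
      by (simp only: abs_minus_commute)
    moreover have "T * real i / real n \<in> {0..T}" "T * real (Suc i) / real n \<in> {0..T}"
      using that by (auto intro!: grid simp del: of_nat_Suc atLeastAtMost_iff)
    ultimately show ?thesis
      unfolding inc power2_eq_square by (subst fBm_increments_covariance[OF B]) (simp_all add: \<sigma>_def)
  qed
  have N0: "expectation (\<lambda>\<omega>. increment T n i B \<omega> * increment T n j B \<omega>) \<le> 0"
    if "i < j" "j < n" for i j
    unfolding inc using that by (intro fBm_disjoint_increments_nonpos[OF B H] grid lt) auto
  have N: "expectation (\<lambda>\<omega>. increment T n i B \<omega> * increment T n j B \<omega>) \<le> 0"
    if "i \<in> {..<n}" "j \<in> {..<n}" "i \<noteq> j" for i j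
    using N0[of i j] N0[of j i] that by (cases "i < j") (auto simp: mult.commute)
  show "integrable M (\<lambda>\<omega>. (quadratic_variation T n B \<omega> - real n * \<sigma>)\<^sup>2)"
    "expectation (\<lambda>\<omega>. (quadratic_variation T n B \<omega> - real n * \<sigma>)\<^sup>2) \<le> 4 * real n * \<sigma>\<^sup>2"
    using variance_sum_squares_le[of "{..<n}" "\<lambda>i. increment T n i B", OF _ G E S N]
    by (simp_all add: quadratic_variation_def)
qed

text \<open>The mean is the same for every \<open>n\<close>, so after scaling by a geometric factor
  the first moments are summable.\<close>

lemma (in prob_space) Wiener_quadratic_variation:
  assumes W: "standard_Wiener_process M {0..T} W" and "0 < T" "0 < n"
  shows "integrable M (quadratic_variation T n W)"
    and "expectation (quadratic_variation T n W) = T"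
proof -
  have inc: "integrable M (\<lambda>\<omega>. (increment T n i W \<omega>)\<^sup>2) \<and>
      expectation (\<lambda>\<omega>. (increment T n i W \<omega>)\<^sup>2) = T / real n" if "i < n" for i
  proof -
    let ?s = "T * real i / real n" and ?t = "T * real (Suc i) / real n"
    have "?s \<in> {0..T}" "?t \<in> {0..T}"
      using that \<open>0 < T\<close> by (auto intro!: grid_point_in_interval simp del: of_nat_Suc atLeastAtMost_iff)
    moreover have "?s < ?t"
      using \<open>0 < T\<close> \<open>0 < n\<close> by (intro divide_strict_right_mono mult_strict_left_mono) auto
    moreover have "?t - ?s = T / real n"
      by (simp add: diff_divide_distrib[symmetric] algebra_simps)
    ultimately have "distributed M lborel (\<lambda>\<omega>. W ?t \<omega> - W ?s \<omega>) (normal_density 0 (sqrt (T / real n)))"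
      using W unfolding standard_Wiener_process_def by metis
    then have D: "distributed M lborel (increment T n i W) (normal_density 0 (sqrt (T / real n)))"
      by (simp add: increment_def[abs_def] add.commute)
    show ?thesis
      using distributed_normal_even_moment[OF D, of 1] \<open>0 < T\<close> \<open>0 < n\<close> by simp
  qed
  then show "integrable M (quadratic_variation T n W)"
    unfolding quadratic_variation_def[abs_def] by auto
  show "expectation (quadratic_variation T n W) = T"
    unfolding quadratic_variation_def[abs_def] using inc \<open>0 < n\<close> by simp
qed

section \<open>Almost sure limits along dyadic grids\<close>

lemma (in prob_space) fBm_dyadic_quadratic_variation_AE:
  assumes B: "fractional_Brownian_motion M H {0..T} B" and H: "H < 1 / 2" and "0 < T"
  shows "AE \<omega> in M. (\<lambda>k. 2 powr (real k * (2 * H - 1)) * quadratic_variation T (2 ^ k) B \<omega>)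
    \<longlonglongrightarrow> T powr (2 * H)"
proof -
  define r where "r k = 2 powr (real k * (2 * H - 1))" for k
  define \<sigma> where "\<sigma> k = (T / 2 ^ k) powr (2 * H)" for k :: nat
  define D where "D k \<omega> = quadratic_variation T (2 ^ k) B \<omega> - 2 ^ k * \<sigma> k" for k \<omega>
  \<comment> \<open>The scaling \<open>r k\<close> is chosen so that the scaled mean is the limit
    itself for every \<open>k\<close>; only the fluctuation \<open>D k\<close> remains to be
    controlled.\<close>
  have r\<sigma>: "r k * (2 ^ k * \<sigma> k) = T powr (2 * H)" for k
    using \<open>0 < T\<close>
    by (simp add: r_def \<sigma>_def powr_divide powr_realpow[symmetric] powr_powr algebra_simps
        powr_diff powr_add)
  note D = fBm_quadratic_variation[OF B H \<open>0 < T\<close>, of "2 ^ k" for k, simplified, folded \<sigma>_def, folded D_def]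
  have "AE \<omega> in M. (\<lambda>k. (r k * D k \<omega>)\<^sup>2) \<longlonglongrightarrow> 0"
  proof (rule AE_tendsto_zero_of_summable_expectation)
    show "integrable M (\<lambda>\<omega>. (r k * D k \<omega>)\<^sup>2)" for k
      using D(1) by (simp add: power_mult_distrib)
    have le: "norm (expectation (\<lambda>\<omega>. (r k * D k \<omega>)\<^sup>2)) \<le> 4 * (T powr (2 * H))\<^sup>2 * (1 / 2) ^ k" for k
    proof -
      have "expectation (\<lambda>\<omega>. (r k * D k \<omega>)\<^sup>2) = (r k)\<^sup>2 * expectation (\<lambda>\<omega>. (D k \<omega>)\<^sup>2)"
        by (simp add: power_mult_distrib)
      also have "\<dots> \<le> (r k)\<^sup>2 * (4 * 2 ^ k * (\<sigma> k)\<^sup>2)"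
        by (intro mult_left_mono D(2)) simp
      \<comment> \<open>One factor \<open>2 ^ k\<close> is traded for \<open>2 ^ (2 * k)\<close> to
        form the square of the constant scaled mean, which leaves the geometric factor.\<close>
      also have "\<dots> = 4 * (r k * (2 ^ k * \<sigma> k))\<^sup>2 * (1 / 2) ^ k"
        by (simp add: power2_eq_square field_simps)
      finally show ?thesis by (simp add: r\<sigma>)
    qed
    have "summable (\<lambda>k. 4 * (T powr (2 * H))\<^sup>2 * (1 / 2) ^ k)"
      by (intro summable_mult summable_geometric) simp
    then show "summable (\<lambda>k. expectation (\<lambda>\<omega>. (r k * D k \<omega>)\<^sup>2))"
      by (rule summable_comparison_test') (rule le)
  qed simp
  then show ?thesis
  proof eventually_elim
    case (elim \<omega>)
    then have "(\<lambda>k. r k * D k \<omega>) \<longlonglongrightarrow> 0" by simp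
    then have "(\<lambda>k. r k * D k \<omega> + T powr (2 * H)) \<longlonglongrightarrow> 0 + T powr (2 * H)"
      by (intro tendsto_intros)
    moreover have "r k * D k \<omega> + T powr (2 * H) = r k * quadratic_variation T (2 ^ k) B \<omega>" for k
      by (simp add: D_def right_diff_distrib r\<sigma>)
    ultimately show ?case by (simp add: r_def)
  qed
qed

lemma (in prob_space) Wiener_dyadic_quadratic_variation_AE:
  assumes W: "standard_Wiener_process M {0..T} W" and "0 < T" and H: "H < 1 / 2"
  shows "AE \<omega> in M. (\<lambda>k. 2 powr (real k * (2 * H - 1)) * quadratic_variation T (2 ^ k) W \<omega>) \<longlonglongrightarrow> 0"
proof (rule AE_tendsto_zero_of_summable_expectation)
  note V = Wiener_quadratic_variation[OF W \<open>0 < T\<close>, of "2 ^ k" for k, simplified]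
  show "integrable M (\<lambda>\<omega>. 2 powr (real k * (2 * H - 1)) * quadratic_variation T (2 ^ k) W \<omega>)" for k
    using V(1) by simp
  show "0 \<le> 2 powr (real k * (2 * H - 1)) * quadratic_variation T (2 ^ k) W \<omega>" for k \<omega>
    by (simp add: quadratic_variation_def sum_nonneg)
  \<comment> \<open>The ratio of the geometric series is below 1 exactly because
    \<open>H < 1 / 2\<close>.\<close>
  have "2 powr (2 * H - 1) < (2 :: real) powr 0"
    using H by (intro powr_less_mono) auto
  then have "summable (\<lambda>k. (2 powr (2 * H - 1)) ^ k * T)"
    by (intro summable_mult2 summable_geometric) simp
  then show "summable (\<lambda>k. expectation
      (\<lambda>\<omega>. 2 powr (real k * (2 * H - 1)) * quadratic_variation T (2 ^ k) W \<omega>))"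
    by (simp add: V(2) powr_power mult.commute)
qed

section \<open>Pathwise limits for the mixed process and the estimators\<close>

text \<open>The argument runs along a single path \<open>\<omega>\<close>: by Cauchy-Schwarz the
  squared scaled cross term is at most the product of the two scaled variations, one convergent and
  the other vanishing.\<close>

lemma mixed_quadratic_variation_tendsto:
  assumes B: "(\<lambda>k. r k * quadratic_variation T (n k) B \<omega>) \<longlonglongrightarrow> L"
    and W: "(\<lambda>k. r k * quadratic_variation T (n k) W \<omega>) \<longlonglongrightarrow> 0"
  shows "(\<lambda>k. r k * quadratic_variation T (n k) (mixed_process a b B W) \<omega>) \<longlonglongrightarrow> a\<^sup>2 * L"
proof -
  define C where "C k = (\<Sum>i<n k. increment T (n k) i B \<omega> * increment T (n k) i W \<omega>)" for k
  have inc: "increment T n i (mixed_process a b B W) \<omega> =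
      a * increment T n i B \<omega> + b * increment T n i W \<omega>" for n i
    by (simp add: increment_def mixed_process_def algebra_simps)
  have split: "quadratic_variation T (n k) (mixed_process a b B W) \<omega> =
      a\<^sup>2 * quadratic_variation T (n k) B \<omega> + 2 * a * b * C k
        + b\<^sup>2 * quadratic_variation T (n k) W \<omega>" for k
    unfolding quadratic_variation_def C_def inc sum_distrib_left sum.distrib[symmetric]
    by (intro sum.cong refl) (simp add: power2_eq_square algebra_simps)
  have "(\<lambda>k. (r k * C k)\<^sup>2) \<longlonglongrightarrow> 0"
  proof (rule tendsto_sandwich[OF _ _ tendsto_const])
    show "(\<lambda>k. (r k * quadratic_variation T (n k) B \<omega>) * (r k * quadratic_variation T (n k) W \<omega>)) \<longlonglongrightarrow> 0"
      using tendsto_mult[OF B W] by simp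
    have "(r k * C k)\<^sup>2 \<le> (r k)\<^sup>2 * (quadratic_variation T (n k) B \<omega> * quadratic_variation T (n k) W \<omega>)" for k
      unfolding power_mult_distrib C_def quadratic_variation_def
      by (intro mult_left_mono Cauchy_Schwarz_ineq_sum) simp
    then show "\<forall>\<^sub>F k in sequentially. (r k * C k)\<^sup>2 \<le>
        (r k * quadratic_variation T (n k) B \<omega>) * (r k * quadratic_variation T (n k) W \<omega>)"
      by (simp add: power2_eq_square mult_ac)
  qed simp
  then have C: "(\<lambda>k. r k * C k) \<longlonglongrightarrow> 0" by simp
  have "(\<lambda>k. a\<^sup>2 * (r k * quadratic_variation T (n k) B \<omega>) + 2 * a * b * (r k * C k)
      + b\<^sup>2 * (r k * quadratic_variation T (n k) W \<omega>)) \<longlonglongrightarrow> a\<^sup>2 * L + 2 * a * b * 0 + b\<^sup>2 * 0"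
    by (intro tendsto_intros B W C)
  then show ?thesis unfolding split by (simp add: algebra_simps)
qed

text \<open>With \<open>u k\<close> the scaled sequence,
  \<open>log 2 (v k) = log 2 (u k) + k * (1 - 2 * H)\<close>. Dividing by \<open>k\<close> kills the
  bounded term, and differencing consecutive logarithms cancels its limit, so the value of
  \<open>L\<close> drops out of both estimators.\<close>

lemma Hurst_estimators_tendsto:
  fixes v :: "nat \<Rightarrow> real"
  assumes lim: "(\<lambda>k. 2 powr (real k * (2 * H - 1)) * v k) \<longlonglongrightarrow> L" and "0 < L"
  shows "(\<lambda>k. 1 / 2 * (1 - 1 / real k * log 2 (v k))) \<longlonglongrightarrow> H"
    and "(\<lambda>k. 1 / 2 * (log 2 (v k / v (k + 1)) + 1)) \<longlonglongrightarrow> H"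
proof -
  define u where "u k = 2 powr (real k * (2 * H - 1)) * v k" for k
  have u: "u \<longlonglongrightarrow> L" using lim by (simp add: u_def[abs_def])
  have log_u: "(\<lambda>k. log 2 (u k)) \<longlonglongrightarrow> log 2 L"
    using u \<open>0 < L\<close> by (intro tendsto_intros) auto
  have ev: "\<forall>\<^sub>F k in sequentially. 0 < v k"
    using order_tendstoD(1)[OF u \<open>0 < L\<close>] by eventually_elim (simp add: u_def zero_less_mult_iff)
  have log_v: "log 2 (v k) = log 2 (u k) - real k * (2 * H - 1)" if "0 < v k" for k
    using that by (simp add: u_def log_mult)
  have "(\<lambda>k. H - 1 / 2 * (log 2 (u k) * (1 / real k))) \<longlonglongrightarrow> H - 1 / 2 * (log 2 L * 0)"
    by (intro tendsto_intros log_u lim_1_over_n)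
  \<comment> \<open>The identity needs \<open>v k > 0\<close> for the logarithm and
    \<open>k > 0\<close>: at \<open>k = 0\<close> the convention \<open>1 / 0 = 0\<close> makes the
    right side \<open>1 / 2\<close>.\<close>
  moreover have "\<forall>\<^sub>F k in sequentially. H - 1 / 2 * (log 2 (u k) * (1 / real k)) =
      1 / 2 * (1 - 1 / real k * log 2 (v k))"
    using ev eventually_gt_at_top[of 0] by eventually_elim (simp add: log_v field_simps)
  ultimately show "(\<lambda>k. 1 / 2 * (1 - 1 / real k * log 2 (v k))) \<longlonglongrightarrow> H"
    by (auto intro: Lim_transform_eventually)
  have "(\<lambda>k. H + 1 / 2 * (log 2 (u k) - log 2 (u (Suc k)))) \<longlonglongrightarrow> H + 1 / 2 * (log 2 L - log 2 L)"
    by (intro tendsto_intros log_u log_u[THEN LIMSEQ_Suc])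
  moreover have "\<forall>\<^sub>F k in sequentially. H + 1 / 2 * (log 2 (u k) - log 2 (u (Suc k))) =
      1 / 2 * (log 2 (v k / v (k + 1)) + 1)"
    using ev ev[THEN eventually_sequentially_Suc[THEN iffD2]]
    by eventually_elim (simp add: log_v log_divide field_simps)
  ultimately show "(\<lambda>k. 1 / 2 * (log 2 (v k / v (k + 1)) + 1)) \<longlonglongrightarrow> H"
    by (auto intro: Lim_transform_eventually)
qed

theorem theorem3p1:
  fixes P :: "'a measure" and B W :: "real \<Rightarrow> 'a \<Rightarrow> real" and H T a b :: real
  assumes "prob_space P"
    and "T > 0" and "a > 0" and "b > 0"
    and "0 < H" and "H < 1 / 2"
    and "fractional_Brownian_motion P H {0..T} B"
    and "standard_Wiener_process P {0..T} W"
    and "independent_processes P {0..T} B W"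
  shows "(AE \<omega> in P. (\<lambda>k. H_hat T (mixed_process a b B W) k \<omega>) \<longlonglongrightarrow> H) \<and>
         (AE \<omega> in P. (\<lambda>k. H_tilde T (mixed_process a b B W) k \<omega>) \<longlonglongrightarrow> H)"
proof -
  interpret prob_space P by fact
  \<comment> \<open>Positivity of the limit makes the logarithm continuous there.\<close>
  have pos: "0 < a\<^sup>2 * T powr (2 * H)" using assms by simp
  \<comment> \<open>On the event where both scaled variations converge, the two pathwise lemmas
    apply with \<open>L = a^2 * T powr (2 * H)\<close>.\<close>
  have "AE \<omega> in P. (\<lambda>k. H_hat T (mixed_process a b B W) k \<omega>) \<longlonglongrightarrow> H \<and>
      (\<lambda>k. H_tilde T (mixed_process a b B W) k \<omega>) \<longlonglongrightarrow> H"
    using fBm_dyadic_quadratic_variation_AE[OF assms(7,6,2)]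
      Wiener_dyadic_quadratic_variation_AE[OF assms(8,2,6)]
  proof eventually_elim
    case (elim \<omega>)
    show ?case
      unfolding H_hat_def H_tilde_def
      using Hurst_estimators_tendsto[OF mixed_quadratic_variation_tendsto[OF elim] pos] by simp
  qed
  then show ?thesis by auto
qed

end
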